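(* Let $X$ be a topological space, and let $\Phi,\Psi:X\to\mathbb{R}$ be two sequentially lower semicontinuous functions. Denote by $I$ the set of all $\rho>\inf_X\Psi$ such that the set $\Psi^{-1}(]-\infty,\rho[)$ is contained in some sequentially compact subset of $X$. Assume that $I\neq\emptyset$. For each $\rho\in I$, denote by $\mathcal{F}_\rho$ the family of all sequentially compact subsets of $X$ containing $\Psi^{-1}(]-\infty,\rho[)$, and put $$\alpha(\rho)=\sup_{K\in\mathcal{F}_\rho}\inf_K\Phi.$$ Then, for each $\rho\in I$ and each $\lambda$ satisfying $$\lambda>\inf_{x\in\Psi^{-1}(]-\infty,\rho[)}\frac{\Phi(x)-\alpha(\rho)}{\rho-\Psi(x)},$$ the restriction of the function $\Phi+\lambda\Psi$ to $\Psi^{-1}(]-\infty,\rho[)$ has a global minimum.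
   Context: $]a,b[$ denotes the open interval with endpoints $a,b$. A subset $K$ of $X$ is sequentially compact if every sequence in $K$ has a subsequence converging to a point of $K$. A function having a global minimum means that its infimum is attained. *)

theory Defs
  imports "HOL-Analysis.Analysis"
begin

definition seq_lsc :: "('a::topological_space \<Rightarrow> real) \<Rightarrow> bool" where
  "seq_lsc f \<longleftrightarrow>
     (\<forall>s x. s \<longlonglongrightarrow> x \<longrightarrow> ereal (f x) \<le> liminf (\<lambda>n. ereal (f (s n))))"

definition sublev :: "('a \<Rightarrow> real) \<Rightarrow> real \<Rightarrow> 'a set" where
  "sublev \<Psi> \<rho> = \<Psi> -` {..<\<rho>}"

text \<open>
  Infima and suprema of real-valued functions are taken in the extended reals, so that an
  unbounded family has the infimum \<open>-\<infinity>\<close> or the supremum \<open>\<infinity>\<close> instead of an unspecified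
  real value.
\<close>

definition adm_levels :: "('a::topological_space \<Rightarrow> real) \<Rightarrow> real set" where
  "adm_levels \<Psi> =
     {\<rho>. ereal \<rho> > (INF x. ereal (\<Psi> x)) \<and> (\<exists>K. seq_compact K \<and> sublev \<Psi> \<rho> \<subseteq> K)}"

definition seq_compact_supersets ::
    "('a::topological_space \<Rightarrow> real) \<Rightarrow> real \<Rightarrow> 'a set set" where
  "seq_compact_supersets \<Psi> \<rho> = {K. seq_compact K \<and> sublev \<Psi> \<rho> \<subseteq> K}"

definition alpha ::
    "('a::topological_space \<Rightarrow> real) \<Rightarrow> ('a \<Rightarrow> real) \<Rightarrow> real \<Rightarrow> ereal" where
  "alpha \<Phi> \<Psi> \<rho> = (SUP K\<in>seq_compact_supersets \<Psi> \<rho>. INF x\<in>K. ereal (\<Phi> x))"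

definition has_global_min_on :: "('a \<Rightarrow> real) \<Rightarrow> 'a set \<Rightarrow> bool" where
  "has_global_min_on f S \<longleftrightarrow> (\<exists>x\<in>S. ereal (f x) = (INF y\<in>S. ereal (f y)))"

end

theory Submission
  imports Defs
begin

text \<open>
  The idea is to minimise over a well chosen sequentially compact superset of the sublevel set
  and to see that the minimiser cannot leave the sublevel set. Write \<open>S\<close> for the sublevel set.
  Every sequentially compact \<open>K \<supseteq> S\<close> has \<open>inf\<^sub>K \<Phi> \<le> inf\<^sub>S \<Phi>\<close>, so \<open>\<alpha>(\<rho>)\<close> is a lower bound of \<open>\<Phi>\<close>
  on \<open>S\<close>. The quotients in the hypothesis are therefore nonnegative, and \<open>\<lambda> > 0\<close>;
  this positivity makes \<open>\<Phi> + \<lambda>\<Psi>\<close> sequentially lower semicontinuous, so that it attains its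
  minimum on each nonempty sequentially compact set (\<open>seq_lsc_attains_min\<close>).

  The hypothesis on \<open>\<lambda>\<close> provides \<open>x \<in> S\<close> with \<open>\<Phi> x + \<lambda> (\<Psi> x - \<rho>) < \<alpha>(\<rho>)\<close>. As \<open>\<alpha>(\<rho>)\<close> is a
  supremum, some sequentially compact \<open>K \<supseteq> S\<close> satisfies
  \<open>\<Phi> x + \<lambda> \<Psi> x < inf\<^sub>K \<Phi> + \<lambda>\<rho>\<close>. On \<open>K - S\<close> one has \<open>\<Psi> \<ge> \<rho>\<close>, hence \<open>\<Phi> + \<lambda>\<Psi> \<ge> inf\<^sub>K \<Phi> + \<lambda>\<rho>\<close> there,
  which is more than the value at \<open>x \<in> K\<close>. So a minimiser over \<open>K\<close> lies in \<open>S\<close>.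
\<close>

lemma seq_lsc_add:
  assumes "seq_lsc f" and "seq_lsc g"
  shows "seq_lsc (\<lambda>x. f x + g x)"
  unfolding seq_lsc_def
proof (intro allI impI)
  fix s x assume s: "s \<longlonglongrightarrow> (x::'a)"
  let ?F = "liminf (\<lambda>n. ereal (f (s n)))" and ?G = "liminf (\<lambda>n. ereal (g (s n)))"
  have le: "ereal (f x) \<le> ?F" "ereal (g x) \<le> ?G"
    using assms s by (auto simp: seq_lsc_def)
  have "ereal (f x + g x) \<le> ?F + ?G"
    using add_mono[OF le] by simp
  also have "\<dots> \<le> liminf (\<lambda>n. ereal (f (s n)) + ereal (g (s n)))"
    by (rule ereal_liminf_add_mono) (use le in auto)
  finally show "ereal (f x + g x) \<le> liminf (\<lambda>n. ereal (f (s n) + g (s n)))"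
    by simp
qed

lemma seq_lsc_cmult:
  assumes "seq_lsc f" and "c > 0"
  shows "seq_lsc (\<lambda>x. c * f x)"
  unfolding seq_lsc_def
proof (intro allI impI)
  fix s x assume s: "s \<longlonglongrightarrow> (x::'a)"
  have "ereal (f x) \<le> liminf (\<lambda>n. ereal (f (s n)))"
    using assms s by (auto simp: seq_lsc_def)
  then have "ereal c * ereal (f x) \<le> ereal c * liminf (\<lambda>n. ereal (f (s n)))"
    using assms(2) by (intro ereal_mult_left_mono) auto
  also have "\<dots> = liminf (\<lambda>n. ereal c * ereal (f (s n)))"
    using assms(2) by (subst Liminf_ereal_mult_left) auto
  finally show "ereal (c * f x) \<le> liminf (\<lambda>n. ereal (c * f (s n)))"
    by simp
qed

text \<open>
  A minimising sequence in \<open>K\<close> has a subsequence converging in \<open>K\<close>, and lower semicontinuity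
  along it bounds the value at the limit by the infimum.
\<close>

lemma seq_lsc_attains_min:
  assumes "seq_lsc f" and "seq_compact K" and "K \<noteq> {}"
  obtains y where "y \<in> K" and "\<And>z. z \<in> K \<Longrightarrow> f y \<le> f z"
proof -
  let ?m = "INF x\<in>K. ereal (f x)"
  obtain u where u: "\<And>n. u n \<in> (\<lambda>x. ereal (f x)) ` K" "u \<longlonglongrightarrow> ?m"
    using Inf_as_limit[of "(\<lambda>x. ereal (f x)) ` K"] assms(3) by auto
  have "\<forall>n. \<exists>x\<in>K. u n = ereal (f x)"
    using u(1) by blast
  then obtain s where s: "\<And>n. s n \<in> K" "\<And>n. u n = ereal (f (s n))"
    by metis
  obtain y r where y: "y \<in> K" "strict_mono r" "(s \<circ> r) \<longlonglongrightarrow> y"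
    using assms(2) s(1) unfolding seq_compact_def by blast
  have "(\<lambda>n. ereal (f ((s \<circ> r) n))) \<longlonglongrightarrow> ?m"
    using LIMSEQ_subseq_LIMSEQ[OF u(2) y(2)] s(2) by (simp add: o_def)
  then have "liminf (\<lambda>n. ereal (f ((s \<circ> r) n))) = ?m"
    by (intro lim_imp_Liminf) auto
  then have "ereal (f y) \<le> ?m"
    using assms(1) y(3) unfolding seq_lsc_def by metis
  then have "f y \<le> f z" if "z \<in> K" for z
    using INF_lower[OF that, of "\<lambda>x. ereal (f x)"] by (metis ereal_less_eq(3) order_trans)
  then show thesis
    using that y(1) by blast
qed

lemma alpha_le:
  assumes "x \<in> sublev \<Psi> \<rho>"
  shows "alpha \<Phi> \<Psi> \<rho> \<le> ereal (\<Phi> x)"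
  unfolding alpha_def
  by (rule SUP_least, rule INF_lower) (use assms in \<open>auto simp: seq_compact_supersets_def\<close>)

theorem theorem2p1:
  fixes \<Phi> \<Psi> :: "'a::topological_space \<Rightarrow> real"
  assumes "seq_lsc \<Phi>" and "seq_lsc \<Psi>"
    and "adm_levels \<Psi> \<noteq> {}"
  shows "\<forall>\<rho>\<in>adm_levels \<Psi>. \<forall>lam::real.
           ereal lam > (INF x\<in>sublev \<Psi> \<rho>. (ereal (\<Phi> x) - alpha \<Phi> \<Psi> \<rho>) / ereal (\<rho> - \<Psi> x)) \<longrightarrow>
           has_global_min_on (\<lambda>x. \<Phi> x + lam * \<Psi> x) (sublev \<Psi> \<rho>)"
proof (intro ballI allI impI)
  fix \<rho> lam
  let ?S = "sublev \<Psi> \<rho>" and ?f = "\<lambda>x. \<Phi> x + lam * \<Psi> x"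
  assume "ereal lam > (INF x\<in>?S. (ereal (\<Phi> x) - alpha \<Phi> \<Psi> \<rho>) / ereal (\<rho> - \<Psi> x))"
  then obtain x where x: "x \<in> ?S"
    and lt: "(ereal (\<Phi> x) - alpha \<Phi> \<Psi> \<rho>) / ereal (\<rho> - \<Psi> x) < ereal lam"
    by (auto simp: INF_less_iff)
  have pos: "\<rho> - \<Psi> x > 0"
    using x by (simp add: sublev_def)
  have "0 \<le> ereal (\<Phi> x) - alpha \<Phi> \<Psi> \<rho>"
    using alpha_le[OF x, of \<Phi>] by (cases "alpha \<Phi> \<Psi> \<rho>") auto
  then have "0 \<le> (ereal (\<Phi> x) - alpha \<Phi> \<Psi> \<rho>) / ereal (\<rho> - \<Psi> x)"
    using pos by (simp add: zero_le_divide_ereal)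
  with lt have lam: "lam > 0"
    by (metis ereal_less(2) le_less_trans)
  have "ereal (\<Phi> x + lam * (\<Psi> x - \<rho>)) < alpha \<Phi> \<Psi> \<rho>"
    using lt pos alpha_le[OF x, of \<Phi>]
    by (cases "alpha \<Phi> \<Psi> \<rho>") (auto simp: field_simps)
  then obtain K where K: "seq_compact K" "?S \<subseteq> K"
    and K_lt: "ereal (\<Phi> x + lam * (\<Psi> x - \<rho>)) < (INF y\<in>K. ereal (\<Phi> y))"
    by (auto simp: alpha_def less_SUP_iff seq_compact_supersets_def)
  have "seq_lsc ?f"
    using assms(1,2) lam by (intro seq_lsc_add seq_lsc_cmult)
  then obtain y where y: "y \<in> K" "\<And>z. z \<in> K \<Longrightarrow> ?f y \<le> ?f z"
    using seq_lsc_attains_min[of ?f K] K x by blast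
  have "y \<in> ?S"
  proof (rule ccontr)
    assume "y \<notin> ?S"
    then have "lam * \<rho> \<le> lam * \<Psi> y"
      using lam by (simp add: sublev_def)
    moreover have "\<Phi> x + lam * (\<Psi> x - \<rho>) < \<Phi> y"
      using less_le_trans[OF K_lt INF_lower[OF y(1)]] by simp
    ultimately have "?f x < ?f y"
      by (simp add: algebra_simps)
    with y(2)[of x] x K(2) show False
      by auto
  qed
  moreover have "ereal (?f y) = (INF z\<in>?S. ereal (?f z))"
    using \<open>y \<in> ?S\<close> y(2) K(2)
    by (intro antisym INF_greatest INF_lower) (auto simp del: plus_ereal.simps)
  ultimately show "has_global_min_on ?f ?S"
    unfolding has_global_min_on_def by blast
qed

end
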